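(* Let $G$ be a connected graph and let $k\ge4$. If $G$ is $(k,1)$-chordal, then $G$ satisfies the Bottleneck Property (BP). Moreover, (BP) holds with constant $\Delta=\frac{k}{4}+\frac52$.
   Context: Every edge of the connected graph $G$ has length $1$, interior points of edges are points of $G$, and $d$ is the induced shortest-path (length) metric on $G$, making $G$ a geodesic metric space. Paths are finite and simple. A cycle is a simple closed curve, given by a sequence of vertices all different except that the first and last coincide. $L(\cdot)$ denotes length. For a cycle $C$, $d_C$ denotes the length metric on $C$. A shortcut in $C$ is a path $\sigma$ in $G$ joining two vertices $p,q$ of $C$ with $L(\sigma)<d_C(p,q)$. The graph $G$ is $(k,m)$-chordal if for every cycle $C$ in $G$ with $L(C)\ge k$ there is a shortcut $\sigma$ of $C$ with $L(\sigma)\le m$. It is always assumed that $k\ge 4$ and $k\ge 2m$. A geodesic metric space $(X,d)$ satisfies the Bottleneck Property (BP) with constant $\Delta>0$ if, given any two distinct points $x,y\in X$ and any midpoint $z$, i.e. $d(x,z)=d(z,y)=\frac12 d(x,y)$, every $xy$-path (path in $X$ joining $x$ to $y$) intersects $N_\Delta(z)=\{w : d(z,w)\le\Delta\}$. It satisfies (BP) if it does so for some $\Delta>0$. *)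

theory Defs
  imports "HOL-Analysis.Analysis" "Graph_Theory.Graph_Theory"
begin

text \<open>
  A (possibly infinite) simple graph is a \<^locale>\<open>pair_bidirected_digraph\<close>: a symmetric,
  irreflexive arc relation \<^term>\<open>parcs G\<close> on the vertex set \<^term>\<open>pverts G\<close>, each edge
  being represented by its two orientations.

  The graph as a metric space is its geometric realization in barycentric coordinates: the point
  of the edge \<open>uv\<close> at distance \<open>t\<close> from \<open>u\<close> is the function \<open>(1 - t) u + t v\<close> on vertices, so the
  points given by \<open>(u, v, t)\<close> and \<open>(v, u, 1 - t)\<close> agree, and distinct edges meet only in common
  endpoints.
\<close>

definition vertex_point :: "'a \<Rightarrow> 'a \<Rightarrow> real" where
  "vertex_point v = indicator {v}"

definition edge_point :: "'a \<Rightarrow> 'a \<Rightarrow> real \<Rightarrow> 'a \<Rightarrow> real" where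
  "edge_point u v t = (\<lambda>w. (1 - t) * vertex_point u w + t * vertex_point v w)"

definition graph_points :: "'a pair_pre_digraph \<Rightarrow> ('a \<Rightarrow> real) set" where
  "graph_points G = vertex_point ` pverts G
     \<union> {edge_point u v t | u v t. (u, v) \<in> parcs G \<and> 0 \<le> t \<and> t \<le> 1}"

text \<open>
  \<open>pl_path G x y l\<close>: some piecewise linear path of length \<open>l\<close> runs from \<open>x\<close> to \<open>y\<close>, each of its
  linear pieces lying in a single edge (of length 1). The length metric is the infimum of these
  lengths. The \<open>else\<close> branch of \<open>graph_dist\<close> is irrelevant for points of a connected graph; it makes
  the function nonnegative everywhere, which \<^locale>\<open>Metric_space\<close> requires also off the carrier.
\<close>

inductive pl_path :: "'a pair_pre_digraph \<Rightarrow> ('a \<Rightarrow> real) \<Rightarrow> ('a \<Rightarrow> real) \<Rightarrow> real \<Rightarrow> bool"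
  for G x where
  pl_path_refl: "x \<in> graph_points G \<Longrightarrow> pl_path G x x 0"
| pl_path_step: "\<lbrakk>pl_path G x (edge_point u v s) l; (u, v) \<in> parcs G;
     0 \<le> s; s \<le> 1; 0 \<le> t; t \<le> 1\<rbrakk> \<Longrightarrow> pl_path G x (edge_point u v t) (l + \<bar>s - t\<bar>)"

definition graph_dist :: "'a pair_pre_digraph \<Rightarrow> ('a \<Rightarrow> real) \<Rightarrow> ('a \<Rightarrow> real) \<Rightarrow> real" where
  "graph_dist G x y = (if \<exists>l. pl_path G x y l then Inf {l. pl_path G x y l} else 0)"


text \<open>
  In a symmetric digraph the closed walk \<open>u, v, u\<close> is a \<^const>\<open>pre_digraph.cycle\<close>, although it
  is not a simple closed curve; the length bound excludes it.
\<close>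

definition graph_cycle :: "'a pair_pre_digraph \<Rightarrow> ('a \<times> 'a) list \<Rightarrow> bool" where
  "graph_cycle G C \<longleftrightarrow> pre_digraph.cycle (with_proj G) C \<and> 3 \<le> length C"

definition cycle_subgraph :: "('a \<times> 'a) list \<Rightarrow> 'a pair_pre_digraph" where
  "cycle_subgraph C = \<lparr>pverts = fst ` set C, parcs = set C \<union> (set C)\<inverse>\<rparr>"

definition cycle_dist :: "('a \<times> 'a) list \<Rightarrow> 'a \<Rightarrow> 'a \<Rightarrow> real" where
  "cycle_dist C p q = graph_dist (cycle_subgraph C) (vertex_point p) (vertex_point q)"

definition shortcut :: "'a pair_pre_digraph \<Rightarrow> ('a \<times> 'a) list \<Rightarrow> ('a \<times> 'a) list \<Rightarrow> bool" where
  "shortcut G C \<sigma> \<longleftrightarrow> (\<exists>p \<in> pverts (cycle_subgraph C). \<exists>q \<in> pverts (cycle_subgraph C).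
     pre_digraph.apath (with_proj G) p \<sigma> q \<and> real (length \<sigma>) < cycle_dist C p q)"

definition chordal :: "real \<Rightarrow> real \<Rightarrow> 'a pair_pre_digraph \<Rightarrow> bool" where
  "chordal k m G \<longleftrightarrow> (\<forall>C. graph_cycle G C \<and> k \<le> real (length C) \<longrightarrow>
     (\<exists>\<sigma>. shortcut G C \<sigma> \<and> real (length \<sigma>) \<le> m))"


locale geodesic_metric_space = Metric_space +
  assumes geodesic: "\<lbrakk>x \<in> M; y \<in> M\<rbrakk> \<Longrightarrow>
    \<exists>\<gamma>. \<gamma> 0 = x \<and> \<gamma> (d x y) = y \<and> \<gamma> ` {0..d x y} \<subseteq> M \<and>
      (\<forall>s \<in> {0..d x y}. \<forall>t \<in> {0..d x y}. d (\<gamma> s) (\<gamma> t) = \<bar>s - t\<bar>)"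

text \<open>
  The \<open>xy\<close>-paths range over all continuous paths. As each such path contains a simple one, it
  makes no difference whether paths are required to be simple.
\<close>

definition bottleneck_property_with :: "'b set \<Rightarrow> ('b \<Rightarrow> 'b \<Rightarrow> real) \<Rightarrow> real \<Rightarrow> bool" where
  "bottleneck_property_with M d \<Delta> \<longleftrightarrow> geodesic_metric_space M d \<and> 0 < \<Delta> \<and>
     (\<forall>x \<in> M. \<forall>y \<in> M. \<forall>z \<in> M.
        x \<noteq> y \<and> d x z = d x y / 2 \<and> d z y = d x y / 2 \<longrightarrow>
        (\<forall>g. pathin (Metric_space.mtopology M d) g \<and> g 0 = x \<and> g 1 = y \<longrightarrow>
           g ` {0..1} \<inter> {w \<in> M. d z w \<le> \<Delta>} \<noteq> {}))"

definition bottleneck_property :: "'b set \<Rightarrow> ('b \<Rightarrow> 'b \<Rightarrow> real) \<Rightarrow> bool" where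
  "bottleneck_property M d \<longleftrightarrow> (\<exists>\<Delta>. bottleneck_property_with M d \<Delta>)"


text \<open>The length metric of a connected graph is a metric.\<close>

lemma edge_point_commute: "edge_point u v t = edge_point v u (1 - t)"
  by (simp add: edge_point_def fun_eq_iff)

lemma edge_point_ends [simp]: "edge_point u v 0 = vertex_point u" "edge_point u v 1 = vertex_point v"
  by (simp_all add: edge_point_def)

lemma edge_point_in [intro]:
  "(u, v) \<in> parcs G \<Longrightarrow> 0 \<le> t \<Longrightarrow> t \<le> 1 \<Longrightarrow> edge_point u v t \<in> graph_points G"
  by (auto simp: graph_points_def)

lemma pl_path_in: "pl_path G x y l \<Longrightarrow> x \<in> graph_points G \<and> y \<in> graph_points G"
  by (induction rule: pl_path.induct) auto

lemma pl_path_edge: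
  assumes "(u, v) \<in> parcs G" "0 \<le> s" "s \<le> 1" "0 \<le> t" "t \<le> 1"
  shows "pl_path G (edge_point u v s) (edge_point u v t) \<bar>s - t\<bar>"
  using pl_path_step[OF pl_path_refl, of u v s G t] assms by auto

lemma pl_path_nonneg: "pl_path G x y l \<Longrightarrow> 0 \<le> l"
  by (induction rule: pl_path.induct) auto

lemma pl_path_trans: "pl_path G y z m \<Longrightarrow> pl_path G x y l \<Longrightarrow> pl_path G x z (l + m)"
proof (induction rule: pl_path.induct)
  case (pl_path_step u v s m t)
  then show ?case using pl_path.pl_path_step[of G x u v s "l + m" t] by (simp add: add.assoc)
qed simp

lemma pl_path_sym: "pl_path G x y l \<Longrightarrow> pl_path G y x l"
proof (induction rule: pl_path.induct)
  case (pl_path_step u v s l t)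
  then show ?case
    using pl_path_trans[OF pl_path_step.IH pl_path_edge[of u v G t s]]
    by (simp add: abs_minus_commute add.commute)
qed (rule pl_path_refl)

lemma pl_path_coord: "pl_path G x y l \<Longrightarrow> \<bar>x w - y w\<bar> \<le> l"
proof (induction rule: pl_path.induct)
  case (pl_path_step u v s l t)
  let ?c = "vertex_point v w - vertex_point u w"
  have "\<bar>edge_point u v s w - edge_point u v t w\<bar> = \<bar>(s - t) * ?c\<bar>"
    by (rule arg_cong[where f = abs]) (simp add: edge_point_def algebra_simps)
  also have "\<dots> \<le> \<bar>s - t\<bar>"
    by (auto simp: vertex_point_def indicator_def abs_mult)
  finally show ?case using pl_path_step.IH by linarith
qed simp

context pair_bidirected_digraph
begin

lemma pl_path_reachable:
  assumes "(u, v) \<in> (parcs G)\<^sup>*" "u \<in> pverts G"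
  shows "\<exists>l. pl_path G (vertex_point u) (vertex_point v) l"
  using assms(1)
proof (induction rule: rtrancl_induct)
  case base
  have "vertex_point u \<in> graph_points G" using assms(2) by (auto simp: graph_points_def)
  then show ?case by (blast intro: pl_path_refl)
next
  case (step v w)
  then show ?case
    using pl_path_trans[OF pl_path_edge[of v w G 0 1]] by fastforce
qed

lemma pl_path_to_vertex:
  assumes "x \<in> graph_points G"
  shows "\<exists>v \<in> pverts G. \<exists>l. pl_path G (vertex_point v) x l"
proof -
  consider v where "v \<in> pverts G" "x = vertex_point v"
    | u v t where "(u, v) \<in> parcs G" "0 \<le> t" "t \<le> 1" "x = edge_point u v t"
    using assms by (auto simp: graph_points_def)
  then show ?thesis
  proof cases
    case 1
    then show ?thesis using assms by (auto intro: pl_path_refl)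
  next
    case 2
    then show ?thesis using pl_path_edge[of u v G 0 t] in_arcsD1 by fastforce
  qed
qed

lemma pl_path_exists:
  assumes "Digraph_Component.connected (with_proj G)" "x \<in> graph_points G" "y \<in> graph_points G"
  shows "\<exists>l. pl_path G x y l"
proof -
  obtain u v l m where uv: "u \<in> pverts G" "v \<in> pverts G"
    "pl_path G (vertex_point u) x l" "pl_path G (vertex_point v) y m"
    using assms(2,3) pl_path_to_vertex by meson
  have "strongly_connected (with_proj G)"
    using assms(1) pair_sym_arcs by (rule symmetric_connected_imp_strongly_connected[rotated])
  then have "(u, v) \<in> (parcs G)\<^sup>*"
    using uv reachable_rtranclI[of "with_proj G" u v] by (auto simp: strongly_connected_def)
  then obtain n where "pl_path G (vertex_point u) (vertex_point v) n"
    using pl_path_reachable uv by blast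
  then show ?thesis using uv by (meson pl_path_sym pl_path_trans)
qed

lemma graph_dist_le: "pl_path G x y l \<Longrightarrow> graph_dist G x y \<le> l"
  unfolding graph_dist_def by (auto intro!: cInf_lower bdd_belowI pl_path_nonneg)

lemma graph_dist_greatest:
  "pl_path G x y l \<Longrightarrow> (\<And>l. pl_path G x y l \<Longrightarrow> b \<le> l) \<Longrightarrow> b \<le> graph_dist G x y"
  unfolding graph_dist_def by (auto intro!: cInf_greatest)

lemma graph_dist_nonneg: "0 \<le> graph_dist G x y"
  unfolding graph_dist_def by (auto intro!: cInf_greatest intro: pl_path_nonneg)

lemma Metric_space_graph:
  assumes conn: "Digraph_Component.connected (with_proj G)"
  shows "Metric_space (graph_points G) (graph_dist G)"
proof
  show "0 \<le> graph_dist G x y" for x y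
    by (rule graph_dist_nonneg)
  have "pl_path G x y = pl_path G y x" for x y
    using pl_path_sym by blast
  then show "graph_dist G x y = graph_dist G y x" for x y
    by (simp add: graph_dist_def)
next
  fix x y assume xy: "x \<in> graph_points G" "y \<in> graph_points G"
  show "graph_dist G x y = 0 \<longleftrightarrow> x = y"
  proof
    assume 0: "graph_dist G x y = 0"
    have "\<bar>x w - y w\<bar> \<le> graph_dist G x y" for w
      using pl_path_exists[OF conn xy] by (auto intro: graph_dist_greatest pl_path_coord)
    then show "x = y" using 0 by (simp add: fun_eq_iff)
  next
    assume "x = y"
    then show "graph_dist G x y = 0"
      using graph_dist_le[OF pl_path_refl[OF xy(1)]] graph_dist_nonneg[of x x] by simp
  qed
next
  fix x y z assume xyz: "x \<in> graph_points G" "y \<in> graph_points G" "z \<in> graph_points G"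
  obtain l\<^sub>0 m\<^sub>0 where l0: "pl_path G x y l\<^sub>0" and m0: "pl_path G y z m\<^sub>0"
    using pl_path_exists[OF conn] xyz by meson
  have "graph_dist G x z - m \<le> graph_dist G x y" if "pl_path G y z m" for m
  proof (rule graph_dist_greatest[OF l0])
    fix l assume "pl_path G x y l"
    then show "graph_dist G x z - m \<le> l"
      using graph_dist_le[OF pl_path_trans[OF that]] by fastforce
  qed
  then have "graph_dist G x z - graph_dist G x y \<le> graph_dist G y z"
    by (intro graph_dist_greatest[OF m0]) (simp add: algebra_simps)
  then show "graph_dist G x z \<le> graph_dist G x y + graph_dist G y z"
    by simp
qed

end

end

theory Submission
  imports Defs
begin

text \<open>
  Let \<open>z\<close> be a midpoint of \<open>x\<close> and \<open>y\<close>, and suppose that a continuous path from \<open>x\<close> to \<open>y\<close>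
  avoids the closed ball of radius \<open>\<Delta> = k / 4 + 5 / 2\<close> about \<open>z\<close>. Every point of the path is
  within distance less than 1 of a vertex, so the vertices at distance more than \<open>\<Delta> - 1\<close> from \<open>z\<close>,
  the set \<open>W\<close>, already contain an edge walk along the path (\<open>path_vertices_linked\<close>). On the other
  hand, some geodesic from \<open>x\<close> to \<open>y\<close> runs through \<open>z\<close>; up to partial edges at \<open>x\<close> and \<open>y\<close> it consists
  of an edge geodesic \<open>v 0, \<dots>, v N\<close> (\<open>vertex_geodesic_through_midpoint\<close>), which splits into a half before \<open>z\<close> and a half after \<open>z\<close>.

  Among all walks inside \<open>W\<close> that lead from a neighbour of the second half to a neighbour of the
  first half take a shortest one, \<open>p 0, \<dots>, p h\<close>, and attach it to the geodesic as close to \<open>z\<close> as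
  possible, at \<open>v j\<close> and \<open>v i\<close>. The closed curve \<open>v i, \<dots>, v j, p 0, \<dots>, p h, v i\<close> is then an
  induced cycle: a chord inside the geodesic or inside \<open>p\<close> would shorten it, and a chord between the
  two would contradict either minimality of \<open>p\<close> or the choice of \<open>i\<close> and \<open>j\<close>. Since the geodesic is
  no longer than the detour \<open>v i, p h, \<dots>, p 0, v j\<close>, the cycle has length at least \<open>2 (j - i)\<close>. A
  \<open>(k, 1)\<close>-chordal graph has no induced cycle of length \<open>k\<close> or more, because a shortcut of length at
  most 1 is a chord; hence \<open>2 (j - i) < k\<close> (\<open>chordal_link_is_short\<close>).

  But \<open>v i\<close> and \<open>v j\<close> are adjacent to vertices of \<open>W\<close> and lie on different sides of \<open>z\<close>, so both are
  farther than \<open>\<Delta> - 2\<close> from \<open>z\<close> and \<open>j - i > 2 (\<Delta> - 2) = k / 2 + 1\<close>, a contradiction.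

  The metric part rests on one normal form (\<open>pl_path_imp_route\<close>): each piecewise linear path can be
  replaced by one that is no longer and either stays in one edge or leaves \<open>x\<close> through an
  end of its edge, follows edges, and enters the edge of \<open>y\<close> through an end. Below any bound, such
  paths have only finitely many lengths, so distances are attained; this makes the graph a geodesic
  space and yields the edge geodesics above.
\<close>

section \<open>Shortest walks of a relation\<close>

lemma relpow_of_steps:
  assumes "s \<le> u" "\<And>t. s \<le> t \<Longrightarrow> t < u \<Longrightarrow> (f t, f (Suc t)) \<in> R"
  shows "(f s, f u) \<in> R ^^ (u - s)"
  using assms
proof (induction u rule: dec_induct)
  case base
  then show ?case by simp
next
  case (step u)
  then show ?case by (auto simp: Suc_diff_le)
qed

text \<open>
  If \<open>p\<close> realizes the least number of steps from \<open>A\<close> to \<open>B\<close>, then replacing a part of it by any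
  other walk cannot save steps. With \<open>d = 0\<close> and \<open>d = 1\<close> the fourth property says that \<open>p\<close> is
  injective and has no chords.
\<close>

lemma shortest_link:
  assumes "a \<in> A" "b \<in> B" "(a, b) \<in> R\<^sup>*"
  obtains p h where "p 0 \<in> A" "p h \<in> B"
    "\<And>t. t < h \<Longrightarrow> (p t, p (Suc t)) \<in> R"
    "\<And>s t d. s \<le> t \<Longrightarrow> t \<le> h \<Longrightarrow> (p s, p t) \<in> R ^^ d \<Longrightarrow> t \<le> s + d"
    "\<And>t. t \<le> h \<Longrightarrow> p t \<in> A \<Longrightarrow> t = 0"
    "\<And>t. t \<le> h \<Longrightarrow> p t \<in> B \<Longrightarrow> t = h"
proof -
  let ?P = "\<lambda>h. \<exists>a \<in> A. \<exists>b \<in> B. (a, b) \<in> R ^^ h"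
  define h where "h = (LEAST h. ?P h)"
  have "\<exists>h. ?P h" using assms rtrancl_imp_relpow by metis
  then have "?P h" unfolding h_def by (rule LeastI_ex)
  then obtain p where p: "p 0 \<in> A" "p h \<in> B" and st: "\<And>t. t < h \<Longrightarrow> (p t, p (Suc t)) \<in> R"
    unfolding relpow_fun_conv by blast
  have le: "h \<le> d" if "a \<in> A" "b \<in> B" "(a, b) \<in> R ^^ d" for a b d
    unfolding h_def using that by (intro Least_le) blast
  have seg: "(p s, p t) \<in> R ^^ (t - s)" if "s \<le> t" "t \<le> h" for s t
    using that by (intro relpow_of_steps st) auto
  show thesis
  proof (rule that[OF p st])
    fix s t d assume "s \<le> t" "t \<le> h" and d: "(p s, p t) \<in> R ^^ d"
    then have "(p 0, p h) \<in> R ^^ (s + d + (h - t))"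
      unfolding relpow_add using seg[of 0 s] seg[of t h] by auto
    then show "t \<le> s + d" using le[OF p] \<open>t \<le> h\<close> by fastforce
  next
    fix t assume "t \<le> h" "p t \<in> A"
    then show "t = 0" using le[OF _ p(2) seg[of t h]] by simp
  next
    fix t assume "t \<le> h" "p t \<in> B"
    then show "t = h" using le[OF p(1) _ seg[of 0 t]] by simp
  qed
qed

section \<open>Cycles and chords\<close>

definition arc_chain :: "(nat \<Rightarrow> 'a) \<Rightarrow> nat \<Rightarrow> nat \<Rightarrow> ('a \<times> 'a) list" where
  "arc_chain f i j = map (\<lambda>m. (f m, f (Suc m))) [i..<j]"

context pair_bidirected_digraph
begin

lemma relpow_parcs_sym: "(u, w) \<in> parcs G ^^ n \<Longrightarrow> (w, u) \<in> parcs G ^^ n"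
proof (induction n arbitrary: w)
  case (Suc n)
  then obtain v where "(u, v) \<in> parcs G ^^ n" "(v, w) \<in> parcs G" by auto
  then show ?case using Suc.IH arcs_symmetric relpow_Suc_I2 by metis
qed simp

lemma awalk_arc_chain:
  assumes "i \<le> j" "f i \<in> pverts G" "\<And>m. i \<le> m \<Longrightarrow> m < j \<Longrightarrow> (f m, f (Suc m)) \<in> parcs G"
  shows "awalk (f i) (arc_chain f i j) (f j)"
  using assms
proof (induction j rule: dec_induct)
  case base
  then show ?case by (simp add: arc_chain_def awalk_Nil_iff)
next
  case (step j)
  then show ?case
    by (auto simp: arc_chain_def awalk_simps dest: in_arcsD2)
qed

text \<open>
  The cycle of the main argument consists of two chains, a part of a geodesic and a detour, and is
  built directly from them to keep its arcs recognizable.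
\<close>

lemma graph_cycle_of_two_chains:
  assumes "i \<le> j" "3 \<le> j - i + h + 2"
    and v: "\<And>m. i \<le> m \<Longrightarrow> m < j \<Longrightarrow> (v m, v (Suc m)) \<in> parcs G"
    and p: "\<And>t. t < h \<Longrightarrow> (p t, p (Suc t)) \<in> parcs G"
    and join: "(v j, p 0) \<in> parcs G" "(p h, v i) \<in> parcs G"
    and inj: "inj_on v {i..j}" "inj_on p {..h}" "v ` {i..j} \<inter> p ` {..h} = {}"
  shows "graph_cycle G (arc_chain v i j @ (v j, p 0) # arc_chain p 0 h @ [(p h, v i)])"
    (is "graph_cycle G ?C")
proof -
  have V: "v i \<in> pverts G" "p 0 \<in> pverts G" using join in_arcsD2 by auto
  have "awalk (p 0) (arc_chain p 0 h) (p h)" "awalk (v i) (arc_chain v i j) (v j)"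
    using V assms by (auto intro!: awalk_arc_chain)
  then have walk: "awalk (v i) ?C (v i)"
    using join V by (auto simp: awalk_simps)
  have snd: "map snd (arc_chain f a b) = map f [Suc a..<Suc b]" for f :: "nat \<Rightarrow> 'a" and a b
    by (simp add: arc_chain_def map_Suc_upt[symmetric] del: upt_Suc)
  have "map snd ?C = map v [Suc i..<Suc j] @ p 0 # map p [Suc 0..<Suc h] @ [v i]"
    by (simp add: snd del: upt_Suc)
  also have "\<dots> = map v [Suc i..<Suc j] @ map p [0..<Suc h] @ [v i]"
    by (simp add: upt_conv_Cons[of 0 "Suc h"] del: upt_Suc)
  finally have snds: "map snd ?C = \<dots>" .
  have "v i \<notin> v ` {Suc i..<Suc j}"
  proof
    assume "v i \<in> v ` {Suc i..<Suc j}"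
    then obtain m where "v m = v i" "Suc i \<le> m" "m \<le> j" by auto
    then show False using inj_onD[OF inj(1), of m i] by simp
  qed
  moreover have "inj_on v {Suc i..<Suc j}" by (rule inj_on_subset[OF inj(1)]) auto
  moreover have "inj_on p {0..<Suc h}" by (rule inj_on_subset[OF inj(2)]) auto
  moreover have "v ` {Suc i..<Suc j} \<inter> p ` {0..<Suc h} = {}" "v i \<notin> p ` {0..<Suc h}"
  proof -
    have "v ` {Suc i..<Suc j} \<subseteq> v ` {i..j}" "p ` {0..<Suc h} \<subseteq> p ` {..h}" "v i \<in> v ` {i..j}"
      using assms(1) by (auto intro!: imageI)
    then show "v ` {Suc i..<Suc j} \<inter> p ` {0..<Suc h} = {}" "v i \<notin> p ` {0..<Suc h}"
      using inj(3) by blast+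
  qed
  ultimately have "distinct (map snd ?C)"
    unfolding snds by (simp add: distinct_map del: upt_Suc image_Suc_atLeastLessThan)
  moreover have "tl (awalk_verts (v i) ?C) = map snd ?C"
    using walk awalk_verts_conv'[of "v i" ?C "v i"] by (auto simp: awalk_def)
  ultimately have "cycle ?C"
    using walk unfolding cycle_def by auto
  then show ?thesis
    using assms(1,2) by (simp add: graph_cycle_def arc_chain_def)
qed

text \<open>
  A shortcut of length at most 1 is a chord. It has length exactly 1, since a path of length 0 is
  not shorter than the distance between its ends, and it is not an edge of the cycle, since the ends
  of such an edge have distance at most 1 in the cycle.
\<close>
lemma chordal_chord:
  assumes "chordal k 1 G" "graph_cycle G C" "k \<le> real (length C)"
  obtains a b where "(a, b) \<in> parcs G" "a \<in> fst ` set C" "b \<in> fst ` set C"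
    "(a, b) \<notin> set C" "(b, a) \<notin> set C"
proof -
  obtain \<sigma> a b where ab: "a \<in> fst ` set C" "b \<in> fst ` set C" "apath a \<sigma> b"
    and lt: "real (length \<sigma>) < cycle_dist C a b" and "length \<sigma> \<le> 1"
    using assms unfolding chordal_def shortcut_def cycle_subgraph_def by fastforce
  let ?H = "cycle_subgraph C"
  have le: "cycle_dist C a b \<le> l" if "pl_path ?H (vertex_point a) (vertex_point b) l" for l
    unfolding cycle_dist_def graph_dist_def
    using that by (auto intro!: cInf_lower bdd_belowI pl_path_nonneg)
  consider "\<sigma> = []" | e where "\<sigma> = [e]"
    using \<open>length \<sigma> \<le> 1\<close> by (cases \<sigma>) auto
  then show thesis
  proof cases
    case 1
    then have "a = b" using ab(3) by (simp add: apath_simps)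
    moreover have "vertex_point a \<in> graph_points ?H"
      using ab(1) by (auto simp: graph_points_def cycle_subgraph_def)
    ultimately show thesis using le[OF _] pl_path_refl[of "vertex_point a" ?H] lt by fastforce
  next
    case 2
    then have arc: "(a, b) \<in> parcs G" using ab(3) by (auto simp: apath_simps)
    have "(a, b) \<notin> parcs ?H"
      using le[of 1] pl_path_edge[of a b ?H 0 1] lt 2 by auto
    then show thesis using that[OF arc ab(1,2)] by (auto simp: cycle_subgraph_def)
  qed
qed

section \<open>Detours around the midpoint of a geodesic\<close>

text \<open>
  The geodesic \<open>v\<close> is cut between \<open>v n\<close> and \<open>v (n + 1)\<close>. The assumptions \<open>gapL\<close> and \<open>gapR\<close> say that
  \<open>W\<close> contains no vertex next to the cut. A vertex of \<open>W\<close> on the geodesic then has a neighbour in its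
  own half and cannot have one in the other half, which is what keeps a shortest detour disjoint from
  the geodesic.
\<close>

lemma chordal_link_is_short:
  assumes chordal: "chordal k 1 G" "4 \<le> k"
    and v: "\<And>i. i < N \<Longrightarrow> (v i, v (Suc i)) \<in> parcs G"
    and geo: "\<And>i j d. i \<le> j \<Longrightarrow> j \<le> N \<Longrightarrow> (v i, v j) \<in> parcs G ^^ d \<Longrightarrow> j \<le> i + d"
    and "n < N" "v 0 \<in> W" "v N \<in> W" "(v N, v 0) \<in> (parcs G \<inter> W \<times> W)\<^sup>*"
    and gapL: "\<And>i. i \<le> n \<Longrightarrow> v i \<in> W \<Longrightarrow> i < n"
    and gapR: "\<And>j. n < j \<Longrightarrow> j \<le> N \<Longrightarrow> v j \<in> W \<Longrightarrow> Suc n < j"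
  shows "\<exists>i j. i \<le> n \<and> n < j \<and> j \<le> N \<and> 2 * real (j - i) < k \<and>
    (\<exists>w \<in> W. (v i, w) \<in> parcs G) \<and> (\<exists>w \<in> W. (v j, w) \<in> parcs G)"
proof (rule ccontr)
  assume "\<not> ?thesis"
  then have far: "k \<le> 2 * real (j - i)" if "i \<le> n" "n < j" "j \<le> N" "w \<in> W" "w' \<in> W"
    "(v i, w) \<in> parcs G" "(v j, w') \<in> parcs G" for i j w w'
    using that by force
  define A where "A = {w \<in> W. \<exists>i \<le> n. (v i, w) \<in> parcs G}"
  define B where "B = {w \<in> W. \<exists>j. n < j \<and> j \<le> N \<and> (v j, w) \<in> parcs G}"
  have memB: "w \<in> B" if "w \<in> W" "n < j" "j \<le> N" "(v j, w) \<in> parcs G" for w j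
    using that unfolding B_def by blast
  have adj: "(v i, v j) \<in> parcs G \<Longrightarrow> i \<le> N \<Longrightarrow> j \<le> N \<Longrightarrow> i < j \<Longrightarrow> j = Suc i" for i j
    using geo[of i j 1] by auto
  have onL: "v i \<in> A" if "i \<le> n" "v i \<in> W" for i
    using v[of i] gapL[OF that] that \<open>n < N\<close> arcs_symmetric unfolding A_def
    by (auto intro!: exI[of _ "Suc i"])
  have onR: "v j \<in> B" if "n < j" "j \<le> N" "v j \<in> W" for j
    using v[of "j - 1"] gapR[OF that] that unfolding B_def
    by (auto intro!: exI[of _ "j - 1"])
  have "v N \<in> B" "v 0 \<in> A" using onL onR assms by auto
  then obtain p h where p: "p 0 \<in> B" "p h \<in> A"
    and stepW: "\<And>t. t < h \<Longrightarrow> (p t, p (Suc t)) \<in> parcs G \<inter> W \<times> W"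
    and short: "\<And>s t d. s \<le> t \<Longrightarrow> t \<le> h \<Longrightarrow> (p s, p t) \<in> (parcs G \<inter> W \<times> W) ^^ d \<Longrightarrow> t \<le> s + d"
    and inB: "\<And>t. t \<le> h \<Longrightarrow> p t \<in> B \<Longrightarrow> t = 0"
    and inA: "\<And>t. t \<le> h \<Longrightarrow> p t \<in> A \<Longrightarrow> t = h"
    by (rule shortest_link[OF _ _ assms(8)]) blast
  have pW: "p t \<in> W" if "t \<le> h" for t
    using that p stepW[of t] unfolding A_def by (cases "t = h") auto
  \<comment> \<open>The only edge between the halves is the one at the cut, which \<open>W\<close> misses.\<close>
  have A_B: False if "i \<le> n" "n < j" "j \<le> N" "(v i, v j) \<in> parcs G" "v i \<in> W \<or> v j \<in> W" for i j
    using adj[OF that(4)] gapL[of i] gapR[of j] that \<open>n < N\<close> by fastforce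
  \<comment> \<open>If \<open>p\<close> met the first half, it could only be at its last vertex; the vertex before it would then
    already be a neighbour of the first half. If \<open>p\<close> is a single vertex, it is also a neighbour of the
    second half, which \<open>A_B\<close> excludes. The second half is symmetric.\<close>
  have off: "p t \<noteq> v m" if "t \<le> h" "m \<le> N" for t m
  proof
    assume eq: "p t = v m"
    then have mW: "v m \<in> W" using pW[OF that(1)] by simp
    show False
    proof (cases "m \<le> n")
      case True
      then have t: "t = h" using inA[OF that(1)] onL[OF True mW] eq by simp
      show False
      proof (cases h)
        case 0
        then obtain j where "n < j" "j \<le> N" "(v j, v m) \<in> parcs G"
          using p(1) t eq by (auto simp: B_def)
        then show False using A_B[of m j] True mW arcs_symmetric by blast
      next
        case (Suc g)
        then have "(v m, p g) \<in> parcs G" using stepW[of g] t eq arcs_symmetric by auto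
        then have "p g \<in> A" using pW[of g] Suc True by (auto simp: A_def)
        then show False using inA[of g] Suc by simp
      qed
    next
      case False
      then have t: "t = 0" using inB[OF that(1)] onR[OF _ that(2) mW] eq by simp
      show False
      proof (cases "h = 0")
        case True
        then obtain i where "i \<le> n" "(v i, v m) \<in> parcs G"
          using p(2) t eq by (auto simp: A_def)
        then show False using A_B[of i m] False mW that by auto
      next
        case h: False
        then have "p 1 \<in> B"
          using memB[of "p 1" m] pW[of 1] stepW[of 0] t eq False that by simp
        moreover have "1 \<le> h" using h by linarith
        ultimately have "1 = (0 :: nat)" by (intro inB)
        then show False by simp
      qed
    qed
  qed
  \<comment> \<open>Attach the detour as close to the cut as possible, to exclude chords at its two ends.\<close>
  define I where "I = {i. i \<le> n \<and> (v i, p h) \<in> parcs G}"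
  define J where "J = {j. n < j \<and> j \<le> N \<and> (v j, p 0) \<in> parcs G}"
  define i where "i = Max I"
  define j where "j = Min J"
  have fin: "finite I" "finite J" by (auto simp: I_def J_def)
  have "I \<noteq> {}" "J \<noteq> {}" using p by (auto simp: A_def B_def I_def J_def)
  then have "i \<in> I" "j \<in> J" using fin by (auto simp: i_def j_def)
  then have i: "i \<le> n" "(v i, p h) \<in> parcs G" and j: "n < j" "j \<le> N" "(v j, p 0) \<in> parcs G"
    by (auto simp: I_def J_def)
  have imax: "m \<le> i" if "m \<le> n" "(v m, p h) \<in> parcs G" for m
    using fin that by (auto simp: i_def I_def intro!: Max_ge)
  have jmin: "j \<le> m" if "n < m" "m \<le> N" "(v m, p 0) \<in> parcs G" for m
    using fin that by (auto simp: j_def J_def intro!: Min_le)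
  \<comment> \<open>The cycle is long enough: the geodesic part has \<open>j - i\<close> edges, the detour \<open>h + 2\<close>.\<close>
  have k: "k \<le> 2 * real (j - i)" using far[OF i(1) j(1,2) _ _ i(2) j(3)] pW by simp
  have "(p 0, p h) \<in> parcs G ^^ h"
    using relpow_of_steps[of 0 h p "parcs G"] stepW by auto
  then have "(v j, v i) \<in> parcs G ^^ (1 + h + 1)"
    using i(2) j(3) arcs_symmetric unfolding relpow_add by auto
  then have "(v i, v j) \<in> parcs G ^^ (1 + h + 1)" by (rule relpow_parcs_sym)
  then have hij: "j \<le> i + (h + 2)" using geo[of i j "1 + h + 1"] i j by simp
  let ?C = "arc_chain v i j @ (v j, p 0) # arc_chain p 0 h @ [(p h, v i)]"
  have "inj_on v {i..j}"
  proof (rule linorder_inj_onI)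
    show "v m \<noteq> v m'" if "m < m'" "m \<in> {i..j}" "m' \<in> {i..j}" for m m'
      using geo[of m m' 0] that j by auto
  qed auto
  moreover have "inj_on p {..h}"
  proof (rule linorder_inj_onI)
    show "p t \<noteq> p t'" if "t < t'" "t \<in> {..h}" "t' \<in> {..h}" for t t'
      using short[of t t' 0] that by auto
  qed auto
  moreover have "v ` {i..j} \<inter> p ` {..h} = {}" using off j by (auto simp: disjoint_iff) (metis le_trans)
  ultimately have "graph_cycle G ?C"
    using i j k chordal v stepW arcs_symmetric by (intro graph_cycle_of_two_chains) auto
  moreover have "k \<le> real (length ?C)"
    using k hij i j by (simp add: arc_chain_def)
  ultimately obtain a b where ab: "(a, b) \<in> parcs G" "a \<in> fst ` set ?C" "b \<in> fst ` set ?C"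
    and chord: "(a, b) \<notin> set ?C" "(b, a) \<notin> set ?C"
    using chordal_chord[OF chordal(1)] by blast
  have on: "(\<exists>m. i \<le> m \<and> m \<le> j \<and> c = v m) \<or> (\<exists>t \<le> h. c = p t)" if "c \<in> fst ` set ?C" for c
  proof -
    have "c \<in> v ` {i..<j} \<union> {v j} \<union> p ` {0..<h} \<union> {p h}"
      using that by (simp add: arc_chain_def image_Un image_image) blast
    moreover have "i \<le> j" using i j by simp
    ultimately show ?thesis by (elim UnE imageE) (auto intro: less_imp_le)
  qed
  have Cv: "(v m, v (Suc m)) \<in> set ?C" if "i \<le> m" "m < j" for m
    using that by (simp add: arc_chain_def)
  have Cp: "(p t, p (Suc t)) \<in> set ?C" if "t < h" for t
    using that by (simp add: arc_chain_def)
  \<comment> \<open>An edge between two vertices of the cycle is an edge of the cycle.\<close>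
  have vv: False if "i \<le> m" "m < m'" "m' \<le> j" "{a, b} = {v m, v m'}" for m m'
  proof -
    have "(v m, v m') \<in> parcs G" using that ab(1) arcs_symmetric by (auto simp: doubleton_eq_iff)
    then show False using adj[of m m'] Cv[of m] that j chord by (auto simp: doubleton_eq_iff)
  qed
  have pp: False if "t < t'" "t' \<le> h" "{a, b} = {p t, p t'}" for t t'
  proof -
    have "(p t, p t') \<in> parcs G" using that ab(1) arcs_symmetric by (auto simp: doubleton_eq_iff)
    then have "t' = Suc t" using short[of t t' 1] pW that by auto
    then show False using Cp[of t] that chord by (auto simp: doubleton_eq_iff)
  qed
  have vp: False if "i \<le> m" "m \<le> j" "t \<le> h" "{a, b} = {v m, p t}" for m t
  proof -
    have arc: "(v m, p t) \<in> parcs G" using that ab(1) arcs_symmetric by (auto simp: doubleton_eq_iff)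
    show False
    proof (cases "m \<le> n")
      case True
      then have "p t \<in> A" using arc pW that by (auto simp: A_def)
      then have "t = h" using inA that by simp
      then have "m = i" using imax[OF True] arc that by auto
      then show False using \<open>t = h\<close> that chord by (auto simp: doubleton_eq_iff)
    next
      case False
      then have "p t \<in> B" using memB[of "p t" m] arc pW that j by simp
      then have "t = 0" using inB that by simp
      then have "m = j" using jmin[of m] False arc that j by auto
      then show False using \<open>t = 0\<close> that chord by (auto simp: doubleton_eq_iff)
    qed
  qed
  have "a \<noteq> b" using ab(1) no_loops' by blast
  from on[OF ab(2)] on[OF ab(3)] show False
  proof (elim disjE exE conjE)
    show False if "i \<le> m" "m \<le> j" "a = v m" "i \<le> m'" "m' \<le> j" "b = v m'" for m m'
      using that \<open>a \<noteq> b\<close> vv[of m m'] vv[of m' m]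
      by (cases m m' rule: linorder_cases) (simp_all add: insert_commute)
    show False if "t \<le> h" "a = p t" "t' \<le> h" "b = p t'" for t t'
      using that \<open>a \<noteq> b\<close> pp[of t t'] pp[of t' t]
      by (cases t t' rule: linorder_cases) (simp_all add: insert_commute)
    show False if "i \<le> m" "m \<le> j" "a = v m" "t \<le> h" "b = p t" for m t
      using vp[of m t] that by simp
    show False if "i \<le> m" "m \<le> j" "b = v m" "t \<le> h" "a = p t" for m t
      using vp[of m t] that by (simp add: insert_commute)
  qed
qed

end


section \<open>Piecewise linear paths in normal form\<close>

text \<open>
  \<open>u\<close> is an end of the edge carrying \<open>x\<close>, and \<open>x\<close> lies at distance \<open>\<alpha> < 1\<close> from \<open>u\<close> on it. A vertex is
  only offset from itself, not from its neighbours, and an interior point of an edge is offset from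
  its two ends; this makes the representation unique up to swapping the ends (\<open>offset_unique\<close>).
\<close>

definition offset :: "'a pair_pre_digraph \<Rightarrow> ('a \<Rightarrow> real) \<Rightarrow> 'a \<Rightarrow> real \<Rightarrow> bool" where
  "offset G x u \<alpha> \<longleftrightarrow> (u \<in> pverts G \<and> x = vertex_point u \<and> \<alpha> = 0) \<or>
     (\<exists>v. (u, v) \<in> parcs G \<and> 0 < \<alpha> \<and> \<alpha> < 1 \<and> x = edge_point u v \<alpha>)"

text \<open>
  Normal forms of paths are described by their lengths only: the paths themselves never matter, and
  lengths are what has to be shown to attain their infimum.
\<close>

inductive route :: "'a pair_pre_digraph \<Rightarrow> ('a \<Rightarrow> real) \<Rightarrow> ('a \<Rightarrow> real) \<Rightarrow> real \<Rightarrow> bool"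
  for G x y where
  route_in_edge: "\<lbrakk>(u, v) \<in> parcs G; 0 \<le> s; s \<le> 1; 0 \<le> t; t \<le> 1; x = edge_point u v s;
     y = edge_point u v t\<rbrakk> \<Longrightarrow> route G x y \<bar>s - t\<bar>"
| route_via: "\<lbrakk>offset G x u \<alpha>; offset G y w \<beta>; (u, w) \<in> parcs G ^^ n\<rbrakk>
     \<Longrightarrow> route G x y (\<alpha> + real n + \<beta>)"

lemma vertex_point_apply: "vertex_point u w = (if w = u then 1 else 0)"
  by (simp add: vertex_point_def indicator_def)

lemma offset_bounds: "offset G x u \<alpha> \<Longrightarrow> 0 \<le> \<alpha> \<and> \<alpha> < 1"
  by (auto simp: offset_def)

text \<open>
  A piecewise linear path is parametrized by arc length; the distance of two of its points is then at
  most the difference of their parameters. If the path is shortest, the triangle inequality turns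
  this into equality.
\<close>
lemma pl_path_curve:
  assumes "pl_path G x y l"
  shows "\<exists>\<gamma>. \<gamma> 0 = x \<and> \<gamma> l = y \<and>
    (\<forall>s t. 0 \<le> s \<and> s \<le> t \<and> t \<le> l \<longrightarrow> pl_path G (\<gamma> s) (\<gamma> t) (t - s))"
  using assms
proof (induction rule: pl_path.induct)
  case pl_path_refl
  have "pl_path G x x (t - s)" if "0 \<le> s \<and> s \<le> t \<and> t \<le> 0" for s t :: real
  proof -
    have "t - s = 0" using that by linarith
    then show ?thesis using pl_path.pl_path_refl[of x G] \<open>x \<in> graph_points G\<close> by simp
  qed
  then show ?case by (intro exI[of _ "\<lambda>_. x"]) simp
next
  case (pl_path_step u v s l t)
  then obtain \<gamma> where \<gamma>: "\<gamma> 0 = x" "\<gamma> l = edge_point u v s"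
    "\<And>r r'. 0 \<le> r \<Longrightarrow> r \<le> r' \<Longrightarrow> r' \<le> l \<Longrightarrow> pl_path G (\<gamma> r) (\<gamma> r') (r' - r)" by blast
  have l: "0 \<le> l" using pl_path_nonneg pl_path_step by blast
  define e where "e r = (if s \<le> t then s + (r - l) else s - (r - l))" for r
  have e: "0 \<le> e r" "e r \<le> 1" if "l \<le> r" "r \<le> l + \<bar>s - t\<bar>" for r
    using that pl_path_step by (auto simp: e_def)
  have edge: "pl_path G (edge_point u v (e r)) (edge_point u v (e r')) (r' - r)"
    if "l \<le> r" "r \<le> r'" "r' \<le> l + \<bar>s - t\<bar>" for r r'
    using pl_path_edge[OF pl_path_step.hyps(2), of "e r" "e r'"] e[of r] e[of r'] that
    by (auto simp: e_def split: if_splits)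
  have el: "e l = s" "e (l + \<bar>s - t\<bar>) = t" by (auto simp: e_def)
  define \<delta> where "\<delta> r = (if r \<le> l then \<gamma> r else edge_point u v (e r))" for r
  have \<delta>': "\<delta> r = edge_point u v (e r)" if "l \<le> r" for r
    using that \<gamma>(2) el by (auto simp: \<delta>_def)
  have "pl_path G (\<delta> r) (\<delta> r') (r' - r)" if "0 \<le> r" "r \<le> r'" "r' \<le> l + \<bar>s - t\<bar>" for r r'
  proof -
    consider "r' \<le> l" | "l \<le> r" | "r \<le> l" "l \<le> r'" by linarith
    then show ?thesis
    proof cases
      case 1
      then show ?thesis using \<gamma>(3) that by (simp add: \<delta>_def)
    next
      case 2
      then show ?thesis using edge that by (simp add: \<delta>')
    next
      case 3
      then have "pl_path G (\<delta> r) (edge_point u v (e l)) (l - r)"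
        using \<gamma>(3)[of r l] \<gamma>(2) that l el by (simp add: \<delta>_def)
      moreover have "pl_path G (edge_point u v (e l)) (\<delta> r') (r' - l)"
        using edge[of l r'] 3 that by (simp add: \<delta>')
      ultimately show ?thesis using pl_path_trans by fastforce
    qed
  qed
  moreover have "\<delta> 0 = x" using \<gamma>(1) l by (simp add: \<delta>_def)
  moreover have "\<delta> (l + \<bar>s - t\<bar>) = edge_point u v t" using \<delta>'[of "l + \<bar>s - t\<bar>"] el by simp
  ultimately show ?case by (intro exI[of _ \<delta>] conjI allI impI) simp_all
qed

context pair_bidirected_digraph
begin

lemma vertex_point_in: "u \<in> pverts G \<Longrightarrow> vertex_point u \<in> graph_points G"
  by (simp add: graph_points_def)

lemma offset_vertex: "u \<in> pverts G \<Longrightarrow> offset G (vertex_point u) u 0"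
  by (simp add: offset_def)

lemma offset_vertex_mem: "offset G x u \<alpha> \<Longrightarrow> u \<in> pverts G"
  by (auto simp: offset_def dest: in_arcsD1)

lemma offset_edge_point:
  assumes "(u, v) \<in> parcs G" "0 \<le> t" "t < 1" shows "offset G (edge_point u v t) u t"
proof (cases "t = 0")
  case True
  then show ?thesis using offset_vertex[OF in_arcsD1[OF assms(1)]] by simp
next
  case False
  then show ?thesis using assms unfolding offset_def by (intro disjI2 exI[of _ v]) simp
qed

lemma offset_exists:
  assumes "x \<in> graph_points G" obtains u \<alpha> where "offset G x u \<alpha>"
proof -
  consider v where "v \<in> pverts G" "x = vertex_point v"
    | u v t where "(u, v) \<in> parcs G" "0 \<le> t" "t \<le> 1" "x = edge_point u v t"
    using assms by (auto simp: graph_points_def)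
  then show thesis
  proof cases
    case 1
    then show thesis using that offset_vertex by blast
  next
    case 2
    show thesis
    proof (cases "t = 1")
      case True
      then show thesis using that[of v 0] offset_vertex[OF in_arcsD2[OF 2(1)]] 2(4) by simp
    next
      case False
      then show thesis using that[of u t] offset_edge_point[OF 2(1), of t] 2 by simp
    qed
  qed
qed

lemma pl_path_offset:
  assumes "offset G x u \<alpha>" shows "pl_path G x (vertex_point u) \<alpha>"
proof -
  consider "x = vertex_point u" "\<alpha> = 0"
    | v where "(u, v) \<in> parcs G" "x = edge_point u v \<alpha>"
    using assms unfolding offset_def by blast
  then show ?thesis
  proof cases
    case 1
    then show ?thesis using pl_path_refl[OF vertex_point_in[OF offset_vertex_mem[OF assms]]] by simp
  next
    case 2
    then show ?thesis using pl_path_edge[OF 2(1), of \<alpha> 0] offset_bounds[OF assms] by simp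
  qed
qed

lemma offset_of_edge_point:
  assumes "offset G (edge_point u v s) w \<beta>" "(u, v) \<in> parcs G"
  shows "w = u \<and> \<beta> = s \<or> w = v \<and> \<beta> = 1 - s"
proof -
  have "u \<noteq> v" using assms(2) no_loops' by blast
  consider "edge_point u v s = vertex_point w" "\<beta> = 0"
    | w' where "(w, w') \<in> parcs G" "\<beta> < 1" "edge_point u v s = edge_point w w' \<beta>"
    using assms(1) by (auto simp: offset_def)
  then show ?thesis
  proof cases
    case 1
    show ?thesis
      using fun_cong[OF 1(1), of u] fun_cong[OF 1(1), of v] 1(2) \<open>u \<noteq> v\<close>
      by (auto simp: edge_point_def vertex_point_apply split: if_splits)
  next
    case 2
    have "w \<noteq> w'" using 2(1) no_loops' by blast
    then show ?thesis
      using fun_cong[OF 2(3), of w] 2(2) \<open>u \<noteq> v\<close>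
      by (auto simp: edge_point_def vertex_point_apply split: if_splits)
  qed
qed

lemma offset_unique:
  assumes "offset G x u \<alpha>" "offset G x w \<beta>"
  shows "u = w \<and> \<alpha> = \<beta> \<or> (u, w) \<in> parcs G \<and> \<alpha> + \<beta> = 1"
proof -
  consider "x = vertex_point u" "\<alpha> = 0" "x = vertex_point w" "\<beta> = 0"
    | u' where "(u, u') \<in> parcs G" "x = edge_point u u' \<alpha>"
    | w' where "(w, w') \<in> parcs G" "x = edge_point w w' \<beta>"
    using assms unfolding offset_def by blast
  then show ?thesis
  proof cases
    case 1
    then have "(vertex_point u :: 'a \<Rightarrow> real) u = vertex_point w u" by simp
    then show ?thesis using 1(2,4) by (simp add: vertex_point_apply split: if_splits)
  next
    case 2
    then show ?thesis using offset_of_edge_point[of u u' \<alpha> w \<beta>] assms(2) by auto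
  next
    case 3
    then show ?thesis
      using offset_of_edge_point[of w w' \<beta> u \<alpha>] arcs_symmetric[of w w'] assms(1) by auto
  qed
qed

lemma pl_path_relpow:
  assumes "(u, w) \<in> parcs G ^^ n" "u \<in> pverts G"
  shows "pl_path G (vertex_point u) (vertex_point w) (real n)"
  using assms(1)
proof (induction n arbitrary: w)
  case 0
  then show ?case using pl_path_refl[OF vertex_point_in[OF assms(2)]] by simp
next
  case (Suc n)
  then obtain v where v: "(u, v) \<in> parcs G ^^ n" "(v, w) \<in> parcs G" by auto
  have "pl_path G (vertex_point v) (vertex_point w) 1"
    using pl_path_edge[OF v(2), of 0 1] by simp
  from pl_path_trans[OF this Suc.IH[OF v(1)]] show ?case by (simp add: add.commute)
qed

lemma pl_path_route: "route G x y l \<Longrightarrow> pl_path G x y l"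
proof (induction rule: route.induct)
  case (route_in_edge u v s t)
  then show ?case using pl_path_edge[OF route_in_edge(1-5)] by (simp only:)
next
  case (route_via u \<alpha> w \<beta> n)
  have "pl_path G (vertex_point u) (vertex_point w) (real n)"
    using pl_path_relpow[OF route_via(3) offset_vertex_mem[OF route_via(1)]] .
  from pl_path_trans[OF this pl_path_offset[OF route_via(1)]]
  have "pl_path G x (vertex_point w) (\<alpha> + real n)" .
  from pl_path_trans[OF pl_path_sym[OF pl_path_offset[OF route_via(2)]] this]
  show ?case .
qed

text \<open>
  A path that reaches a point through the end \<open>w\<close> of its edge can be rerouted when the point moves
  inside the edge: either \<open>w\<close> stays the right end, or the point has become the other end of the edge
  and one more edge is followed.
\<close>
lemma offset_move:
  assumes "(u, v) \<in> parcs G" "0 \<le> s" "s \<le> 1" "0 \<le> t" "t \<le> 1"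
    and "offset G (edge_point u v s) w \<beta>"
  shows "\<exists>w' \<beta>' n. offset G (edge_point u v t) w' \<beta>' \<and> (w, w') \<in> parcs G ^^ n \<and>
    real n + \<beta>' \<le> \<beta> + \<bar>s - t\<bar>"
proof -
  have *: "\<exists>w' \<beta>' n. offset G (edge_point u v t) w' \<beta>' \<and> (u, w') \<in> parcs G ^^ n \<and>
      real n + \<beta>' \<le> s + \<bar>s - t\<bar>"
    if arc: "(u, v) \<in> parcs G" and t: "0 \<le> t" "t \<le> 1" for u v and s t :: real
  proof (cases "t = 1")
    case True
    then have "offset G (edge_point u v t) v 0" "(u, v) \<in> parcs G ^^ 1"
      using arc by (auto simp: offset_def dest: in_arcsD2)
    moreover have "real 1 + 0 \<le> s + \<bar>s - t\<bar>" using True by simp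
    ultimately show ?thesis by blast
  next
    case False
    then have "offset G (edge_point u v t) u t" "(u, u) \<in> parcs G ^^ 0"
      using arc t by (auto intro: offset_edge_point)
    moreover have "real 0 + t \<le> s + \<bar>s - t\<bar>" by simp
    ultimately show ?thesis by blast
  qed
  consider "w = u" "\<beta> = s" | "w = v" "\<beta> = 1 - s"
    using offset_of_edge_point[OF assms(6,1)] by auto
  then show ?thesis
  proof cases
    case 1
    then show ?thesis using *[of u v t s] assms by simp
  next
    case 2
    have abs: "\<bar>(1 - s) - (1 - t)\<bar> = \<bar>s - t\<bar>" by simp
    have "edge_point v u (1 - t) = edge_point u v t" using edge_point_commute[of u v t] by simp
    then show ?thesis
      using *[of v u "1 - t" "1 - s"] 2 arcs_symmetric[OF assms(1)] assms(4,5)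
      unfolding abs by simp
  qed
qed

text \<open>
  By induction on the path, the normal form is restored after each linear piece. The delicate case
  is a path that has so far stayed in one edge: if its endpoint is a vertex, it may continue into
  another edge and is first rewritten to go through that vertex; if it is an interior point, the next
  piece lies in the same edge, possibly with opposite orientation.
\<close>

lemma pl_path_imp_route:
  assumes "pl_path G x y l" shows "\<exists>l' \<le> l. route G x y l'"
  using assms
proof (induction rule: pl_path.induct)
  case pl_path_refl
  then obtain u \<alpha> where u: "offset G x u \<alpha>" using offset_exists by blast
  then consider "\<alpha> = 0" | v where "(u, v) \<in> parcs G" "x = edge_point u v \<alpha>"
    by (auto simp: offset_def)
  then have "route G x x 0"
  proof cases
    case 1
    then show ?thesis using route_via[OF u u, of 0] by simp
  next
    case 2
    then show ?thesis using route_in_edge[OF 2(1), of \<alpha> \<alpha>] offset_bounds[OF u] by simp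
  qed
  then show ?case by blast
next
  case (pl_path_step u v s l t)
  let ?y = "edge_point u v s" and ?y' = "edge_point u v t"
  note arc = \<open>(u, v) \<in> parcs G\<close>
  have move: "\<exists>w' \<beta>' m. offset G ?y' w' \<beta>' \<and> (w, w') \<in> parcs G ^^ m \<and>
      real m + \<beta>' \<le> \<beta> + \<bar>s - t\<bar>" if "offset G ?y w \<beta>" for w \<beta>
    using offset_move that pl_path_step.hyps by blast
  have via: "\<exists>l' \<le> \<alpha> + real n + \<beta> + \<bar>s - t\<bar>. route G x ?y' l'"
    if a: "offset G x a \<alpha>" "offset G ?y w \<beta>" "(a, w) \<in> parcs G ^^ n" for a \<alpha> w \<beta> n
  proof -
    obtain w' \<beta>' m where w': "offset G ?y' w' \<beta>'" "(w, w') \<in> parcs G ^^ m"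
      "real m + \<beta>' \<le> \<beta> + \<bar>s - t\<bar>" using move a(2) by blast
    then have "(a, w') \<in> parcs G ^^ (n + m)" using a(3) by (auto simp: relpow_add)
    then have "route G x ?y' (\<alpha> + real (n + m) + \<beta>')" by (rule route_via[OF a(1) w'(1)])
    then show ?thesis using w'(3) by (intro exI conjI) auto
  qed
  obtain l' where l': "l' \<le> l" "route G x ?y l'" using pl_path_step.IH by blast
  from l'(2) show ?case
  proof cases
    case (route_via a \<alpha> w \<beta> n)
    then obtain l'' where "l'' \<le> \<alpha> + real n + \<beta> + \<bar>s - t\<bar>" "route G x ?y' l''"
      using via by blast
    then show ?thesis using route_via(1) l'(1) by (intro exI[of _ l'']) simp
  next
    case (route_in_edge a b s' t')
    show ?thesis
    proof (cases "s = 0 \<or> s = 1")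
      case True
      then have "offset G ?y u 0 \<or> offset G ?y v 0"
        using offset_vertex[OF in_arcsD1[OF arc]] offset_vertex[OF in_arcsD2[OF arc]] by auto
      then obtain w where w: "offset G ?y w 0" by blast
      then obtain a' \<alpha> n where "offset G x a' \<alpha>" "(w, a') \<in> parcs G ^^ n" "real n + \<alpha> \<le> \<bar>s' - t'\<bar>"
        using offset_move[of a b t' s' w 0] route_in_edge by (auto simp: abs_minus_commute)
      moreover from this obtain l'' where "l'' \<le> \<alpha> + real n + 0 + \<bar>s - t\<bar>" "route G x ?y' l''"
        using via[OF _ w] relpow_parcs_sym by blast
      ultimately show ?thesis using l'(1) route_in_edge(1) by (intro exI[of _ l'']) simp
    next
      case False
      then have s: "0 < s" "s < 1" using pl_path_step.hyps by auto
      have "offset G ?y u s" "offset G ?y v (1 - s)"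
        using offset_edge_point[of u v s] offset_edge_point[of v u "1 - s"] arc arcs_symmetric s
          edge_point_commute[of u v s] by auto
      then have "u = a \<and> s = t' \<or> u = b \<and> s = 1 - t'" "v = a \<or> v = b" "u \<noteq> v"
        using offset_of_edge_point[of a b t'] route_in_edge no_loops' arc by auto
      then consider "u = a" "v = b" "s = t'" | "u = b" "v = a" "s = 1 - t'" by blast
      then show ?thesis
      proof cases
        case 1
        then have "route G x ?y' \<bar>s' - t\<bar>"
          using route_in_edge pl_path_step.hyps by (intro route.route_in_edge[of a b]) auto
        then show ?thesis using 1 route_in_edge(1) l'(1) by (intro exI[of _ "\<bar>s' - t\<bar>"]) auto
      next
        case 2
        then have "route G x ?y' \<bar>s' - (1 - t)\<bar>"
          using route_in_edge pl_path_step.hyps edge_point_commute[of u v t]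
          by (intro route.route_in_edge[of a b]) auto
        then show ?thesis using 2 route_in_edge(1) l'(1)
          by (intro exI[of _ "\<bar>s' - (1 - t)\<bar>"]) auto
      qed
    qed
  qed
qed

lemma finite_offsets: "finite {\<alpha>. \<exists>u. offset G x u \<alpha>}"
proof (cases "\<exists>u \<alpha>. offset G x u \<alpha>")
  case True
  then obtain u \<alpha> where "offset G x u \<alpha>" by blast
  then have "{\<beta>. \<exists>w. offset G x w \<beta>} \<subseteq> {\<alpha>, 1 - \<alpha>}" using offset_unique by fastforce
  then show ?thesis by (rule finite_subset) simp
qed simp

text \<open>
  Normal forms have only finitely many offsets at \<open>x\<close> and \<open>y\<close>, so the number of edges is the only
  unbounded part of their lengths. A vertex may lie in infinitely many edges, but its coordinate in
  each of them is 0 or 1.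
\<close>

lemma finite_routes: "finite {l. route G x y l \<and> l \<le> c}"
proof -
  define coords where "coords x = {\<alpha>. \<exists>u. offset G x u \<alpha>}" for x
  let ?E = "(\<lambda>(s, t). \<bar>s - t\<bar>) ` (insert 1 (coords x) \<times> insert 1 (coords y))"
  let ?V = "(\<lambda>(\<alpha>, n, \<beta>). \<alpha> + real n + \<beta>) ` (coords x \<times> {..nat \<lceil>c\<rceil>} \<times> coords y)"
  have "l \<in> ?E \<union> ?V" if "route G x y l" "l \<le> c" for l
    using that(1)
  proof cases
    case (route_in_edge u v s t)
    have "s \<in> insert 1 (coords x)" "t \<in> insert 1 (coords y)"
      using route_in_edge offset_edge_point[of u v] unfolding coords_def by (auto simp: less_eq_real_def)
    then have "l \<in> ?E" using route_in_edge(1) by (intro rev_image_eqI[of "(s, t)"]) auto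
    then show ?thesis by blast
  next
    case (route_via u \<alpha> w \<beta> n)
    have "real n \<le> c"
      using route_via(1) that(2) offset_bounds[OF route_via(2)] offset_bounds[OF route_via(3)] by simp
    then have "n \<le> nat \<lceil>c\<rceil>" by linarith
    moreover have "\<alpha> \<in> coords x" "\<beta> \<in> coords y" using route_via by (auto simp: coords_def)
    ultimately have "(\<alpha>, n, \<beta>) \<in> coords x \<times> {..nat \<lceil>c\<rceil>} \<times> coords y" by simp
    then have "l \<in> ?V" by (rule rev_image_eqI) (simp add: route_via(1))
    then show ?thesis by blast
  qed
  then have "{l. route G x y l \<and> l \<le> c} \<subseteq> ?E \<union> ?V" by blast
  then show ?thesis by (rule finite_subset) (auto simp: coords_def finite_offsets)
qed

lemma route_graph_dist:
  assumes "Digraph_Component.connected (with_proj G)" "x \<in> graph_points G" "y \<in> graph_points G"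
  shows "route G x y (graph_dist G x y)"
proof -
  obtain c where c: "route G x y c"
    using pl_path_exists[OF assms] pl_path_imp_route by blast
  let ?S = "{l. route G x y l \<and> l \<le> c}"
  define m where "m = Min ?S"
  have "m \<in> ?S" unfolding m_def using c finite_routes by (intro Min_in) auto
  then have m: "route G x y m" by simp
  have least: "m \<le> l" if "route G x y l" for l
  proof (cases "l \<le> c")
    case True
    then show ?thesis unfolding m_def using that finite_routes by (intro Min_le) auto
  next
    case False
    then show ?thesis using \<open>m \<in> ?S\<close> by simp
  qed
  have "graph_dist G x y = m"
  proof (rule antisym)
    show "graph_dist G x y \<le> m" using m by (intro graph_dist_le pl_path_route)
    show "m \<le> graph_dist G x y"
    proof (rule graph_dist_greatest[OF pl_path_route[OF m]])
      fix l assume "pl_path G x y l"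
      then obtain l' where "l' \<le> l" "route G x y l'" using pl_path_imp_route by blast
      then show "m \<le> l" using least[of l'] by simp
    qed
  qed
  then show ?thesis using m by simp
qed

lemma geodesic_graph:
  assumes conn: "Digraph_Component.connected (with_proj G)"
  shows "geodesic_metric_space (graph_points G) (graph_dist G)"
proof -
  interpret Metric_space "graph_points G" "graph_dist G" using conn by (rule Metric_space_graph)
  show ?thesis
  proof unfold_locales
    fix x y assume xy: "x \<in> graph_points G" "y \<in> graph_points G"
    let ?D = "graph_dist G x y"
    obtain \<gamma> where \<gamma>: "\<gamma> 0 = x" "\<gamma> ?D = y"
      and path: "\<And>s t. 0 \<le> s \<Longrightarrow> s \<le> t \<Longrightarrow> t \<le> ?D \<Longrightarrow> pl_path G (\<gamma> s) (\<gamma> t) (t - s)"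
      using pl_path_curve[OF pl_path_route[OF route_graph_dist[OF conn xy]]] by blast
    have mem: "\<gamma> s \<in> graph_points G" if "0 \<le> s" "s \<le> ?D" for s
      using path[of s s] that pl_path_in by fastforce
    have iso: "graph_dist G (\<gamma> s) (\<gamma> t) = t - s" if "0 \<le> s" "s \<le> t" "t \<le> ?D" for s t
    proof -
      have "?D \<le> graph_dist G x (\<gamma> s) + (graph_dist G (\<gamma> s) (\<gamma> t) + graph_dist G (\<gamma> t) y)"
        using triangle[of x "\<gamma> s" y] triangle[of "\<gamma> s" "\<gamma> t" y] mem[of s] mem[of t] xy that
        by simp
      moreover have "graph_dist G x (\<gamma> s) \<le> s" "graph_dist G (\<gamma> t) y \<le> ?D - t"
        "graph_dist G (\<gamma> s) (\<gamma> t) \<le> t - s"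
        using graph_dist_le[OF path[of 0 s]] graph_dist_le[OF path[of t ?D]]
          graph_dist_le[OF path[of s t]] \<gamma> that by simp_all
      ultimately show ?thesis by linarith
    qed
    have "graph_dist G (\<gamma> s) (\<gamma> t) = \<bar>s - t\<bar>" if "s \<in> {0..?D}" "t \<in> {0..?D}" for s t
      using iso[of s t] iso[of t s] that commute[of "\<gamma> s" "\<gamma> t"]
      by (cases "s \<le> t") simp_all
    then show "\<exists>\<gamma>. \<gamma> 0 = x \<and> \<gamma> ?D = y \<and> \<gamma> ` {0..?D} \<subseteq> graph_points G \<and>
      (\<forall>s \<in> {0..?D}. \<forall>t \<in> {0..?D}. graph_dist G (\<gamma> s) (\<gamma> t) = \<bar>s - t\<bar>)"
      using \<gamma> mem by (intro exI[of _ \<gamma>]) auto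
  qed
qed


section \<open>From continuous paths to walks along edges\<close>

text \<open>
  A shortest path of length less than 1 in normal form contains no full edge, so it stays in one edge
  or crosses a single vertex.
\<close>

lemma near_points_linked:
  assumes conn: "Digraph_Component.connected (with_proj G)"
    and xy: "x \<in> graph_points G" "y \<in> graph_points G" "graph_dist G x y < 1"
    and off: "offset G x u \<alpha>" "offset G y w \<beta>"
    and W: "\<And>v \<gamma>. offset G x v \<gamma> \<Longrightarrow> v \<in> W" "\<And>v \<gamma>. offset G y v \<gamma> \<Longrightarrow> v \<in> W"
  shows "(u, w) \<in> (parcs G \<inter> W \<times> W)\<^sup>*"
proof -
  have adj: "(a, b) \<in> (parcs G \<inter> W \<times> W)\<^sup>*"
    if "a = b \<or> (a, b) \<in> parcs G" "a \<in> W" "b \<in> W" for a b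
    using that by auto
  have uw: "u \<in> W" "w \<in> W" using off W by auto
  from route_graph_dist[OF conn xy(1,2)] show ?thesis
  proof cases
    case (route_in_edge a b s t)
    have "u = a \<or> u = b" "w = a \<or> w = b"
      using offset_of_edge_point[of a b s u \<alpha>] offset_of_edge_point[of a b t w \<beta>] off route_in_edge
      by auto
    then have "u = w \<or> (u, w) \<in> parcs G"
      using route_in_edge(2) arcs_symmetric[OF route_in_edge(2)] by metis
    then show ?thesis using adj uw by blast
  next
    case (route_via u' \<alpha>' w' \<beta>' n)
    have "real n < 1"
      using route_via(1) xy(3) offset_bounds[OF route_via(2)] offset_bounds[OF route_via(3)] by simp
    then have "w' = u'" using route_via(4) by simp
    then have "(u, u') \<in> (parcs G \<inter> W \<times> W)\<^sup>*" "(u', w) \<in> (parcs G \<inter> W \<times> W)\<^sup>*"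
      using adj[OF _ uw(1) W(1)[OF route_via(2)]] adj[OF _ W(2)[OF route_via(3)] uw(2)]
        offset_unique[OF off(1) route_via(2)] offset_unique[OF route_via(3) off(2)] by auto
    then show ?thesis by (rule rtrancl_trans)
  qed
qed

text \<open>
  For parameters \<open>s\<close> and \<open>t\<close>, let \<open>P s t\<close> mean that the vertices near \<open>g s\<close> and those near \<open>g t\<close> are
  linked inside \<open>W\<close>. This is an equivalence relation with open classes, since points at distance less
  than 1 are related, and the unit interval is connected.
\<close>

lemma path_vertices_linked:
  assumes conn: "Digraph_Component.connected (with_proj G)"
    and g: "pathin (Metric_space.mtopology (graph_points G) (graph_dist G)) g"
    and W: "\<And>t v \<gamma>. t \<in> {0..1} \<Longrightarrow> offset G (g t) v \<gamma> \<Longrightarrow> v \<in> W"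
    and ends: "offset G (g 0) u \<alpha>" "offset G (g 1) w \<beta>"
  shows "(u, w) \<in> (parcs G \<inter> W \<times> W)\<^sup>*"
proof -
  interpret Metric_space "graph_points G" "graph_dist G" using conn by (rule Metric_space_graph)
  let ?I = "{0..1 :: real}" and ?R = "(parcs G \<inter> W \<times> W)\<^sup>*"
  define P where "P s t \<longleftrightarrow> (\<forall>u \<alpha> w \<beta>. offset G (g s) u \<alpha> \<longrightarrow> offset G (g t) w \<beta> \<longrightarrow> (u, w) \<in> ?R)" for s t
  have cont: "continuous_map (top_of_set ?I) mtopology g" using g by (simp add: pathin_def)
  have mem: "g t \<in> graph_points G" if "t \<in> ?I" for t
    using continuous_map_funspace[OF cont] that by auto
  have "sym ?R" using arcs_symmetric by (intro sym_rtrancl symI) auto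
  have "P 0 1"
  proof (rule connected_equivalence_relation[OF connected_Icc])
    show "0 \<in> ?I" "1 \<in> ?I" by simp_all
    show "P t s" if "P s t" for s t
      using that \<open>sym ?R\<close> unfolding P_def by (meson symD)
    show "P r t" if rs: "P r s" "P s t" and s: "s \<in> ?I" for r s t
    proof -
      obtain v \<gamma> where "offset G (g s) v \<gamma>" using offset_exists[OF mem[OF s]] by blast
      then show ?thesis using rs unfolding P_def by (meson rtrancl_trans)
    qed
    show "\<exists>T. openin (top_of_set ?I) T \<and> s \<in> T \<and> (\<forall>t \<in> T. P s t)" if s: "s \<in> ?I" for s
    proof -
      obtain T where T: "openin (top_of_set ?I) T" "s \<in> T" "\<And>t. t \<in> T \<Longrightarrow> g t \<in> mball (g s) 1"
        using cont s unfolding continuous_map_to_metric by (metis topspace_euclidean_subtopology zero_less_one)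
      have "P s t" if "t \<in> T" for t
      proof -
        have t: "t \<in> ?I" using openin_imp_subset[OF T(1)] that by blast
        have "graph_dist G (g s) (g t) < 1" using T(3)[OF that] by simp
        then show ?thesis
          unfolding P_def using near_points_linked[OF conn mem[OF s] mem[OF t]] W[OF s] W[OF t] by blast
      qed
      then show ?thesis using T(1,2) by blast
    qed
  qed
  then show ?thesis using ends unfolding P_def by blast
qed

text \<open>
  Normal forms of shortest paths from \<open>x\<close> to \<open>z\<close> and from \<open>z\<close> to \<open>y\<close> are concatenated. They meet
  in \<open>z\<close> through ends \<open>b\<close> and \<open>b'\<close> of its edge. If \<open>b = b'\<close>, then \<open>z\<close> is that vertex, because otherwise
  the path would run back and forth between \<open>z\<close> and \<open>b\<close>; if not, the edge \<open>b b'\<close> contains \<open>z\<close> and is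
  part of the geodesic. The lower bound on \<open>D\<close> ensures that neither half stays in one edge and that
  the second half contains a full edge.
\<close>

lemma vertex_geodesic_through_midpoint:
  assumes conn: "Digraph_Component.connected (with_proj G)"
    and pts: "x \<in> graph_points G" "y \<in> graph_points G" "z \<in> graph_points G"
    and mid: "graph_dist G x z = D / 2" "graph_dist G z y = D / 2" "graph_dist G x y = D" "4 < D"
  obtains v N n \<alpha> \<eta> where "offset G x (v 0) \<alpha>" "offset G y (v N) \<eta>" "D = \<alpha> + real N + \<eta>"
    "\<And>i. i < N \<Longrightarrow> (v i, v (Suc i)) \<in> parcs G"
    "\<And>i j d. i \<le> j \<Longrightarrow> j \<le> N \<Longrightarrow> (v i, v j) \<in> parcs G ^^ d \<Longrightarrow> j \<le> i + d"
    "\<And>i. i \<le> N \<Longrightarrow> graph_dist G (vertex_point (v i)) z \<le> \<bar>\<alpha> + real i - D / 2\<bar>"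
    "\<And>i. i \<le> n \<Longrightarrow> \<alpha> + real i \<le> D / 2" "n < N" "D / 2 < \<alpha> + real (Suc n)"
proof -
  interpret Metric_space "graph_points G" "graph_dist G" using conn by (rule Metric_space_graph)
  have via: "\<exists>u \<alpha> w \<beta> n. offset G p u \<alpha> \<and> offset G q w \<beta> \<and> (u, w) \<in> parcs G ^^ n \<and>
      D / 2 = \<alpha> + real n + \<beta>"
    if "p \<in> graph_points G" "q \<in> graph_points G" "graph_dist G p q = D / 2" for p q
    using route_graph_dist[OF conn that(1,2)]
  proof cases
    case (route_in_edge u v s t)
    then show ?thesis using that(3) mid(4) by auto
  next
    case (route_via u \<alpha> w \<beta> n)
    then show ?thesis using that(3) by metis
  qed
  obtain a \<alpha> b \<beta> n where ab: "offset G x a \<alpha>" "offset G z b \<beta>" "(a, b) \<in> parcs G ^^ n"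
    "D / 2 = \<alpha> + real n + \<beta>" using via[OF pts(1,3) mid(1)] by blast
  obtain b' \<beta>' c \<eta> m where bc: "offset G z b' \<beta>'" "offset G y c \<eta>" "(b', c) \<in> parcs G ^^ m"
    "D / 2 = \<beta>' + real m + \<eta>" using via[OF pts(3,2) mid(2)] by blast
  have D_le: "D \<le> \<alpha> + real d + \<eta>" if "(a, c) \<in> parcs G ^^ d" for d
    using graph_dist_le[OF pl_path_route[OF route_via[OF ab(1) bc(2) that]]] mid(3) by simp
  have \<beta>: "0 \<le> \<beta>" "\<beta> < 1" "0 \<le> \<eta>" "\<eta> < 1" "0 \<le> \<beta>'" "\<beta>' < 1"
    using offset_bounds[OF ab(2)] offset_bounds[OF bc(1)] offset_bounds[OF bc(2)] by simp_all
  \<comment> \<open>\<open>k\<close> is the position of \<open>b'\<close> on the joint walk, \<open>n\<close> that of \<open>b\<close>.\<close>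
  define k where "k = (if b = b' then n else Suc n)"
  define N where "N = k + m"
  have bb: "b = b' \<and> \<beta> = 0 \<and> \<beta>' = 0 \<or> (b, b') \<in> parcs G \<and> b \<noteq> b' \<and> \<beta> + \<beta>' = 1"
  proof (cases "b = b'")
    case True
    then have "\<beta> = \<beta>'" using offset_unique[OF ab(2) bc(1)] no_loops' by blast
    moreover have "(a, c) \<in> parcs G ^^ (n + m)"
      using ab(3) bc(3) True by (auto simp: relpow_add)
    ultimately show ?thesis using D_le[of "n + m"] ab(4) bc(4) True \<beta> by simp
  next
    case False
    then show ?thesis using offset_unique[OF ab(2) bc(1)] by simp
  qed
  have DN: "D = \<alpha> + real N + \<eta>" "real k = real n + \<beta> + \<beta>'"
    using bb ab(4) bc(4) by (auto simp: N_def k_def)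
  obtain f where f: "f 0 = a" "f n = b" "\<And>i. i < n \<Longrightarrow> (f i, f (Suc i)) \<in> parcs G"
    using ab(3) unfolding relpow_fun_conv by blast
  obtain e where e: "e 0 = b'" "e m = c" "\<And>i. i < m \<Longrightarrow> (e i, e (Suc i)) \<in> parcs G"
    using bc(3) unfolding relpow_fun_conv by blast
  define v where "v i = (if i \<le> n then f i else e (i - k))" for i
  have nk: "n \<le> k" "k \<le> Suc n" by (auto simp: k_def)
  have ve: "v i = e (i - k)" if "k \<le> i" for i
    using that nk e(1) f(2) bb by (cases "i = n") (auto simp: v_def k_def split: if_splits)
  have step: "(v i, v (Suc i)) \<in> parcs G" if "i < N" for i
  proof -
    consider "i < n" | "k \<le> i" | "i = n" "k = Suc n" using nk by linarith
    then show ?thesis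
    proof cases
      case 1
      then show ?thesis using f(3) by (simp add: v_def)
    next
      case 2
      then show ?thesis using e(3)[of "i - k"] that by (simp add: ve N_def Suc_diff_le)
    next
      case 3
      then have "v i = b" "v (Suc i) = b'" using f(2) e(1) by (simp_all add: v_def)
      then show ?thesis using bb 3 by (auto simp: k_def split: if_splits)
    qed
  qed
  have v0: "v 0 = a" using f(1) by (simp add: v_def)
  have vN: "v N = c" using ve[of N] e(2) by (simp add: N_def)
  have seg: "(v i, v j) \<in> parcs G ^^ (j - i)" if "i \<le> j" "j \<le> N" for i j
    using that by (intro relpow_of_steps step) auto
  have geo: "j \<le> i + d" if "i \<le> j" "j \<le> N" "(v i, v j) \<in> parcs G ^^ d" for i j d
  proof -
    have "(v 0, v N) \<in> parcs G ^^ (i + d + (N - j))"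
      unfolding relpow_add using seg[of 0 i] seg[of j N] that by auto
    then show ?thesis using D_le DN(1) that(2) unfolding v0 vN by fastforce
  qed
  have half: "\<alpha> + real n + \<beta> = D / 2" "\<beta>' + real m + \<eta> = D / 2" using ab(4) bc(4) by simp_all
  have V: "v i \<in> pverts G" if "i \<le> N" for i
  proof (cases i)
    case 0
    then show ?thesis using v0 offset_vertex_mem[OF ab(1)] by simp
  next
    case (Suc i')
    then show ?thesis using in_arcsD2[OF step[of i']] that by simp
  qed
  have dist: "graph_dist G (vertex_point (v i)) z \<le> \<bar>\<alpha> + real i - D / 2\<bar>" if i: "i \<le> N" for i
  proof (cases "i \<le> n")
    case True
    have "(v i, b) \<in> parcs G ^^ (n - i)"
      using seg[of i n] True f(2) nk by (simp add: v_def N_def)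
    from graph_dist_le[OF pl_path_route[OF route_via[OF offset_vertex[OF V[OF i]] ab(2) this]]]
    show ?thesis using half(1) True \<beta> by (simp add: of_nat_diff)
  next
    case False
    then have ki: "k \<le> i" using nk by simp
    then have "(b', v i) \<in> parcs G ^^ (i - k)"
      using seg[of k i] ve[of k] e(1) i by simp
    then have "(v i, b') \<in> parcs G ^^ (i - k)" by (rule relpow_parcs_sym)
    from graph_dist_le[OF pl_path_route[OF route_via[OF offset_vertex[OF V[OF i]] bc(1) this]]]
    show ?thesis using half DN(2) ki \<beta> by (simp add: of_nat_diff)
  qed
  show thesis
  proof (rule that[of v \<alpha> N \<eta> n])
    show "offset G x (v 0) \<alpha>" "offset G y (v N) \<eta>" using ab bc v0 vN by simp_all
    show "\<alpha> + real i \<le> D / 2" if "i \<le> n" for i using half(1) that \<beta> by simp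
    show "D / 2 < \<alpha> + real (Suc n)" using half(1) \<beta> by simp
    have "0 < m" using half(2) \<beta> mid(4) by (cases m) auto
    then show "n < N" using nk by (simp add: N_def)
  qed (use DN step geo dist in auto)
qed

text \<open>
  The vertex \<open>v i\<close> of the geodesic has the signed position \<open>\<alpha> + i - D / 2\<close> relative to the midpoint,
  whose absolute value bounds its distance from \<open>z\<close>. Vertices of \<open>W\<close> on the geodesic therefore have
  positions beyond \<open>\<Delta> - 1\<close>, which is more than 2 and keeps them away from the cut, and neighbours of \<open>W\<close>
  have positions beyond \<open>\<Delta> - 2\<close>.
\<close>

lemma chordal_bottleneck:
  assumes conn: "Digraph_Component.connected (with_proj G)" and chordal: "chordal k 1 G" "4 \<le> k"
  shows "bottleneck_property_with (graph_points G) (graph_dist G) (k / 4 + 5 / 2)"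
proof -
  interpret Metric_space "graph_points G" "graph_dist G" using conn by (rule Metric_space_graph)
  let ?\<Delta> = "k / 4 + 5 / 2" and ?d = "graph_dist G"
  have False if pts: "x \<in> graph_points G" "y \<in> graph_points G" "z \<in> graph_points G"
    and mid: "?d x z = ?d x y / 2" "?d z y = ?d x y / 2"
    and g: "pathin mtopology g" "g 0 = x" "g 1 = y"
    and avoid: "g ` {0..1} \<inter> {w \<in> graph_points G. ?d z w \<le> ?\<Delta>} = {}" for x y z g
  proof -
    define D where "D = ?d x y"
    define W where "W = {v \<in> pverts G. ?\<Delta> - 1 < ?d (vertex_point v) z}"
    have gm: "g t \<in> graph_points G" if "t \<in> {0..1}" for t
      using continuous_map_funspace[OF g(1)[unfolded pathin_def]] that by auto
    have far: "?\<Delta> < ?d (g t) z" if "t \<in> {0..1}" for t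
      using avoid gm[OF that] that commute[of "g t" z] by (force simp: disjoint_iff)
    have W: "v \<in> W" if "t \<in> {0..1}" "offset G (g t) v \<gamma>" for t v \<gamma>
    proof -
      have "?d (g t) (vertex_point v) < 1"
        using graph_dist_le[OF pl_path_offset[OF that(2)]] offset_bounds[OF that(2)] by simp
      moreover have v: "v \<in> pverts G" using offset_vertex_mem[OF that(2)] .
      ultimately show ?thesis
        using far[OF that(1)] triangle[OF gm[OF that(1)] vertex_point_in[OF v] pts(3)]
        by (simp add: W_def)
    qed
    have "?\<Delta> < D / 2" using far[of 0] g(2) mid(1) by (simp add: D_def)
    then have "4 < D" using chordal(2) by simp
    obtain v N n \<alpha> \<eta> where off: "offset G x (v 0) \<alpha>" "offset G y (v N) \<eta>"
      and steps: "\<And>i. i < N \<Longrightarrow> (v i, v (Suc i)) \<in> parcs G"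
      and geo: "\<And>i j d. i \<le> j \<Longrightarrow> j \<le> N \<Longrightarrow> (v i, v j) \<in> parcs G ^^ d \<Longrightarrow> j \<le> i + d"
      and dist: "\<And>i. i \<le> N \<Longrightarrow> ?d (vertex_point (v i)) z \<le> \<bar>\<alpha> + real i - D / 2\<bar>"
      and left: "\<And>i. i \<le> n \<Longrightarrow> \<alpha> + real i \<le> D / 2" and "n < N" "D / 2 < \<alpha> + real (Suc n)"
      using vertex_geodesic_through_midpoint[OF conn pts mid[folded D_def] D_def[symmetric] \<open>4 < D\<close>]
      by metis
    have right: "D / 2 < \<alpha> + real j" if "n < j" for j
      using \<open>D / 2 < \<alpha> + real (Suc n)\<close> that by simp
    have on_W: "?\<Delta> - 1 < \<bar>\<alpha> + real i - D / 2\<bar>" if "i \<le> N" "v i \<in> W" for i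
      using dist[OF that(1)] that(2) by (simp add: W_def)
    have by_W: "?\<Delta> - 2 < \<bar>\<alpha> + real i - D / 2\<bar>" if "i \<le> N" "w \<in> W" "(v i, w) \<in> parcs G" for i w
    proof -
      have "?d (vertex_point w) (vertex_point (v i)) \<le> 1"
        using graph_dist_le[OF pl_path_edge[OF arcs_symmetric[OF that(3)], of 0 1]] by simp
      then show ?thesis
        using that dist[OF that(1)] triangle[of "vertex_point w" "vertex_point (v i)" z]
          vertex_point_in in_arcsD1[OF that(3)] in_arcsD2[OF that(3)] pts(3)
        by (simp add: W_def)
    qed
    have "(v 0, v N) \<in> (parcs G \<inter> W \<times> W)\<^sup>*"
      using path_vertices_linked[OF conn g(1) W] off g by simp
    moreover have "sym ((parcs G \<inter> W \<times> W)\<^sup>*)"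
      using arcs_symmetric by (intro sym_rtrancl symI) auto
    ultimately have link: "(v N, v 0) \<in> (parcs G \<inter> W \<times> W)\<^sup>*" by (rule symD[rotated])
    have ends: "v 0 \<in> W" "v N \<in> W" using W[of 0] W[of 1] off g by auto
    have gapL: "i < n" if "i \<le> n" "v i \<in> W" for i
    proof -
      have "?\<Delta> - 1 < D / 2 - (\<alpha> + real i)" using on_W[of i] left[of i] that \<open>n < N\<close> by simp
      then have "real i < real n" using \<open>D / 2 < \<alpha> + real (Suc n)\<close> chordal(2) by simp
      then show ?thesis by simp
    qed
    have gapR: "Suc n < j" if "n < j" "j \<le> N" "v j \<in> W" for j
    proof -
      have "?\<Delta> - 1 < \<alpha> + real j - D / 2" using on_W[of j] right[of j] that by simp
      then have "real (Suc n) < real j" using left[of n] chordal(2) by simp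
      then show ?thesis by simp
    qed
    obtain i j w w' where ij: "i \<le> n" "n < j" "j \<le> N" "2 * real (j - i) < k"
      "w \<in> W" "(v i, w) \<in> parcs G" "w' \<in> W" "(v j, w') \<in> parcs G"
      using chordal_link_is_short[OF chordal steps geo \<open>n < N\<close> ends link gapL gapR] by blast
    have "?\<Delta> - 2 < D / 2 - (\<alpha> + real i)" "?\<Delta> - 2 < \<alpha> + real j - D / 2"
      using by_W[of i w] by_W[of j w'] left[of i] right[of j] ij \<open>n < N\<close> by simp_all
    then show False using ij by (simp add: of_nat_diff)
  qed
  then show ?thesis
    unfolding bottleneck_property_with_def using geodesic_graph[OF conn] chordal(2) by fastforce
qed

end

theorem theorem3p15:
  fixes G :: "'a pair_pre_digraph" and k :: real
  assumes "pair_bidirected_digraph G"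
    and "Digraph_Component.connected (with_proj G)"
    and "4 \<le> k"
    and "chordal k 1 G"
  shows "bottleneck_property (graph_points G) (graph_dist G)
    \<and> bottleneck_property_with (graph_points G) (graph_dist G) (k / 4 + 5 / 2)"
  using pair_bidirected_digraph.chordal_bottleneck[OF assms(1,2,4,3)]
  unfolding bottleneck_property_def by blast

end
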